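(* Let $n\ge2$ be an integer, let $\mathfrak g=\mathbb R\ltimes_{J_n(0)}\mathbb R^n$, and let $\alpha,\beta$ be real numbers such that $k(\alpha-1)+1\ne0$ and $k(\beta+1)-1\ne0$ for all integers $k\ge1$ and $n(\alpha-1)(\beta+1)-\alpha+\beta+2\ne0$. Then the bilinear product $\triangle_{(\alpha,\beta)}$ (defined in the context) is a complete left-symmetric structure on the cotangent Lie algebra $T^*\mathfrak g$.
   Context: Lie algebras are real and finite-dimensional. A left-symmetric structure on a Lie algebra $\mathfrak h$ is a bilinear product $\triangle:\mathfrak h\times\mathfrak h\to\mathfrak h$ with $x\triangle(y\triangle z)-(x\triangle y)\triangle z=y\triangle(x\triangle z)-(y\triangle x)\triangle z$ and $[x,y]=x\triangle y-y\triangle x$ for all $x,y,z$. It is complete if for every $x\in\mathfrak h$ the right translation $r_x:y\mapsto y\triangle x$ is a nilpotent endomorphism. For an integer $n\ge2$, $\mathfrak g=\mathbb R\ltimes_{J_n(0)}\mathbb R^n$ is the $(n+1)$-dimensional Lie algebra with basis $t,e_1,\dots,e_n$ whose only nonzero brackets (up to antisymmetry) are $[t,e_{i+1}]=e_i$, $i=1,\dots,n-1$. The cotangent Lie algebra $T^*\mathfrak g=\mathfrak g\oplus\mathfrak g^*$ has bracket $[x+\phi,y+\psi]=[x,y]_{\mathfrak g}+\mathrm{ad}^*_x\psi-\mathrm{ad}^*_y\phi$, where $\mathrm{ad}^*_x\phi=-\phi\circ\mathrm{ad}_x$. Let $z,e^1,\dots,e^n$ be the basis of $\mathfrak g^*$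 dual to $t,e_1,\dots,e_n$ and put $f_i=e^{n-i+1}$. Then $T^*\mathfrak g$ has basis $z,e_1,f_1,\dots,e_n,f_n,t$, and its nonzero brackets (up to antisymmetry) are, for $i=1,\dots,n-1$: $[t,e_{i+1}]=e_i$, $[t,f_{i+1}]=-f_i$, $[e_{i+1},f_{n-i+1}]=z$. For $(\alpha,\beta)$ as in the claim, define for $i=1,\dots,n$ $$\alpha_i=\frac{i(\alpha-1)+1}{(\alpha-1)(i-1)+1},\qquad \beta_i=\frac{i(\beta+1)-1}{-(\beta+1)(i-1)+1},$$ and for $i=1,\dots,n-1$ $$\gamma_i=\frac{\alpha_i\beta_{n-i}-\beta_{n-i}}{2\alpha_i\beta_{n-i}+\alpha_i-\beta_{n-i}}=\frac{(\alpha-1)\{(n-i)(\beta+1)-1\}}{n(\alpha-1)(\beta+1)-(\alpha-1)+\beta+1}.$$ The bilinear product $\triangle=\triangle_{(\alpha,\beta)}$ on $T^*\mathfrak g$ is defined, for $i=1,\dots,n-1$, by $t\triangle e_{i+1}=\alpha_ie_i$, $e_{i+1}\triangle t=(-1+\alpha_i)e_i$, $t\triangle f_{i+1}=\beta_if_i$, $f_{i+1}\triangle t=(1+\beta_i)f_i$, $e_{i+1}\triangle f_{n-i+1}=\gamma_iz$, $f_{n-i+1}\triangle e_{i+1}=(-1+\gamma_i)z$, with all other products of basis vectors equal to zero. *)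

theory Defs
  imports "HOL-Analysis.Analysis"
begin

section \<open>Lie algebras and left-symmetric structures\<close>

definition lie_algebra :: "('a::real_vector \<Rightarrow> 'a \<Rightarrow> 'a) \<Rightarrow> bool" where
  "lie_algebra br \<longleftrightarrow>
     (\<exists>B::'a set. finite B \<and> span B = UNIV) \<and>
     bilinear br \<and>
     (\<forall>x. br x x = 0) \<and>
     (\<forall>x y z. br x (br y z) + br y (br z x) + br z (br x y) = 0)"

definition left_symmetric_structure ::
    "('a::real_vector \<Rightarrow> 'a \<Rightarrow> 'a) \<Rightarrow> ('a \<Rightarrow> 'a \<Rightarrow> 'a) \<Rightarrow> bool" where
  "left_symmetric_structure br pr \<longleftrightarrow>
     lie_algebra br \<and>
     bilinear pr \<and>
     (\<forall>x y z. pr x (pr y z) - pr (pr x y) z = pr y (pr x z) - pr (pr y x) z) \<and>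
     (\<forall>x y. br x y = pr x y - pr y x)"

definition nilpotent_endomorphism :: "('a::real_vector \<Rightarrow> 'a) \<Rightarrow> bool" where
  "nilpotent_endomorphism f \<longleftrightarrow> linear f \<and> (\<exists>k::nat. f ^^ k = (\<lambda>_. 0))"

definition complete_left_symmetric_structure ::
    "('a::real_vector \<Rightarrow> 'a \<Rightarrow> 'a) \<Rightarrow> ('a \<Rightarrow> 'a \<Rightarrow> 'a) \<Rightarrow> bool" where
  "complete_left_symmetric_structure br pr \<longleftrightarrow>
     left_symmetric_structure br pr \<and> (\<forall>x. nilpotent_endomorphism (\<lambda>y. pr y x))"


section \<open>The cotangent Lie algebra\<close>

text \<open>
  On a finite-dimensional space every linear functional is bounded, so the dual space of
  \<^typ>\<open>'g::euclidean_space\<close> is the type \<^typ>\<open>'g::euclidean_space \<Rightarrow>\<^sub>L real\<close>; for the same reason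
  \<^const>\<open>Blinfun\<close> below is always applied to a bounded linear map when \<open>br\<close> is bilinear.
\<close>

definition coad :: "('g::euclidean_space \<Rightarrow> 'g \<Rightarrow> 'g) \<Rightarrow> 'g \<Rightarrow> ('g \<Rightarrow>\<^sub>L real) \<Rightarrow> ('g \<Rightarrow>\<^sub>L real)" where
  "coad br x \<phi> = Blinfun (\<lambda>y. - blinfun_apply \<phi> (br x y))"

definition cotangent_bracket ::
    "('g::euclidean_space \<Rightarrow> 'g \<Rightarrow> 'g) \<Rightarrow> 'g \<times> ('g \<Rightarrow>\<^sub>L real) \<Rightarrow> 'g \<times> ('g \<Rightarrow>\<^sub>L real) \<Rightarrow> 'g \<times> ('g \<Rightarrow>\<^sub>L real)" where
  "cotangent_bracket br X Y =
     (br (fst X) (fst Y), coad br (fst X) (snd Y) - coad br (fst Y) (snd X))"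


section \<open>The Lie algebra \<open>\<real> \<ltimes> \<real>\<^sup>n\<close> defined by the Jordan block \<open>J\<^sub>n(0)\<close>\<close>

text \<open>
  The space \<open>\<real>\<^sup>n\<close> is \<^typ>\<open>real ^ 'n\<close>. Since the index type carries no order, its coordinates are
  numbered by a map \<open>\<nu>\<close>, which in all uses is a bijection from \<open>{1..n}\<close> onto the index type.
  An element of \<open>\<gg> = \<real> \<ltimes> \<real>\<^sup>n\<close> is a pair of its \<open>t\<close>-coordinate and its component in \<open>\<real>\<^sup>n\<close>.
\<close>

type_synonym 'n g_alg = "real \<times> (real ^ 'n)"

type_synonym 'n Tg_alg = "'n g_alg \<times> ('n g_alg \<Rightarrow>\<^sub>L real)"

definition jordan_block0 :: "nat \<Rightarrow> (nat \<Rightarrow> 'n::finite) \<Rightarrow> real ^ 'n ^ 'n" where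
  "jordan_block0 n \<nu> = (\<chi> r c. if \<exists>i. 1 \<le> i \<and> i < n \<and> r = \<nu> i \<and> c = \<nu> (i + 1) then 1 else 0)"

definition g_bracket :: "nat \<Rightarrow> (nat \<Rightarrow> 'n::finite) \<Rightarrow> 'n g_alg \<Rightarrow> 'n g_alg \<Rightarrow> 'n g_alg" where
  "g_bracket n \<nu> x y =
     (0, fst x *\<^sub>R (jordan_block0 n \<nu> *v snd y) - fst y *\<^sub>R (jordan_block0 n \<nu> *v snd x))"

definition g_t :: "'n::finite g_alg" where
  "g_t = (1, 0)"

definition g_e :: "(nat \<Rightarrow> 'n::finite) \<Rightarrow> nat \<Rightarrow> 'n g_alg" where
  "g_e \<nu> i = (0, axis (\<nu> i) 1)"

definition dual_t :: "'n::finite g_alg \<Rightarrow>\<^sub>L real" where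
  "dual_t = Blinfun (\<lambda>x. fst x)"

definition dual_e :: "(nat \<Rightarrow> 'n::finite) \<Rightarrow> nat \<Rightarrow> 'n g_alg \<Rightarrow>\<^sub>L real" where
  "dual_e \<nu> i = Blinfun (\<lambda>x. snd x $ \<nu> i)"


section \<open>The basis \<open>z, e\<^sub>i, f\<^sub>i, t\<close> of the cotangent Lie algebra\<close>

datatype label = Lz | Le nat | Lf nat | Lt

definition labels :: "nat \<Rightarrow> label set" where
  "labels n = {Lz, Lt} \<union> Le ` {1..n} \<union> Lf ` {1..n}"

fun basis_vec :: "nat \<Rightarrow> (nat \<Rightarrow> 'n::finite) \<Rightarrow> label \<Rightarrow> 'n Tg_alg" where
  "basis_vec n \<nu> Lz = (0, dual_t)"
| "basis_vec n \<nu> (Le i) = (g_e \<nu> i, 0)"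
| "basis_vec n \<nu> (Lf i) = (0, dual_e \<nu> (n - i + 1))"
| "basis_vec n \<nu> Lt = (g_t, 0)"

fun coord :: "nat \<Rightarrow> (nat \<Rightarrow> 'n::finite) \<Rightarrow> label \<Rightarrow> 'n Tg_alg \<Rightarrow> real" where
  "coord n \<nu> Lz X = blinfun_apply (snd X) g_t"
| "coord n \<nu> (Le i) X = snd (fst X) $ \<nu> i"
| "coord n \<nu> (Lf i) X = blinfun_apply (snd X) (g_e \<nu> (n - i + 1))"
| "coord n \<nu> Lt X = fst (fst X)"


section \<open>The product\<close>

definition alpha_c :: "real \<Rightarrow> nat \<Rightarrow> real" where
  "alpha_c \<alpha> i = (real i * (\<alpha> - 1) + 1) / ((\<alpha> - 1) * (real i - 1) + 1)"

definition beta_c :: "real \<Rightarrow> nat \<Rightarrow> real" where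
  "beta_c \<beta> i = (real i * (\<beta> + 1) - 1) / (- (\<beta> + 1) * (real i - 1) + 1)"

definition gamma_c :: "nat \<Rightarrow> real \<Rightarrow> real \<Rightarrow> nat \<Rightarrow> real" where
  "gamma_c n \<alpha> \<beta> i =
     (alpha_c \<alpha> i * beta_c \<beta> (n - i) - beta_c \<beta> (n - i)) /
     (2 * alpha_c \<alpha> i * beta_c \<beta> (n - i) + alpha_c \<alpha> i - beta_c \<beta> (n - i))"

text \<open>
  Products of basis vectors. In the last two non-trivial equations, \<open>j = n - i\<close> says that
  \<open>f\<^sub>j\<^sub>+\<^sub>1\<close> is \<open>f\<^sub>n\<^sub>-\<^sub>i\<^sub>+\<^sub>1\<close>.
\<close>

fun basis_product :: "nat \<Rightarrow> (nat \<Rightarrow> 'n::finite) \<Rightarrow> real \<Rightarrow> real \<Rightarrow> label \<Rightarrow> label \<Rightarrow> 'n Tg_alg" where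
  "basis_product n \<nu> \<alpha> \<beta> Lt (Le (Suc i)) =
     (if i \<in> {1..n-1} then alpha_c \<alpha> i *\<^sub>R basis_vec n \<nu> (Le i) else 0)"
| "basis_product n \<nu> \<alpha> \<beta> (Le (Suc i)) Lt =
     (if i \<in> {1..n-1} then (- 1 + alpha_c \<alpha> i) *\<^sub>R basis_vec n \<nu> (Le i) else 0)"
| "basis_product n \<nu> \<alpha> \<beta> Lt (Lf (Suc i)) =
     (if i \<in> {1..n-1} then beta_c \<beta> i *\<^sub>R basis_vec n \<nu> (Lf i) else 0)"
| "basis_product n \<nu> \<alpha> \<beta> (Lf (Suc i)) Lt =
     (if i \<in> {1..n-1} then (1 + beta_c \<beta> i) *\<^sub>R basis_vec n \<nu> (Lf i) else 0)"
| "basis_product n \<nu> \<alpha> \<beta> (Le (Suc i)) (Lf (Suc j)) =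
     (if i \<in> {1..n-1} \<and> j = n - i then gamma_c n \<alpha> \<beta> i *\<^sub>R basis_vec n \<nu> Lz else 0)"
| "basis_product n \<nu> \<alpha> \<beta> (Lf (Suc j)) (Le (Suc i)) =
     (if i \<in> {1..n-1} \<and> j = n - i then (- 1 + gamma_c n \<alpha> \<beta> i) *\<^sub>R basis_vec n \<nu> Lz else 0)"
| "basis_product n \<nu> \<alpha> \<beta> _ _ = 0"

definition tri_product :: "nat \<Rightarrow> (nat \<Rightarrow> 'n::finite) \<Rightarrow> real \<Rightarrow> real \<Rightarrow> 'n Tg_alg \<Rightarrow> 'n Tg_alg \<Rightarrow> 'n Tg_alg" where
  "tri_product n \<nu> \<alpha> \<beta> X Y =
     (\<Sum>p\<in>labels n. \<Sum>q\<in>labels n. (coord n \<nu> p X * coord n \<nu> q Y) *\<^sub>R basis_product n \<nu> \<alpha> \<beta> p q)"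


section \<open>Checks of the encoding\<close>

lemma blinfun_apply_dual_t [simp]: "blinfun_apply dual_t x = fst x"
  unfolding dual_t_def by (simp add: bounded_linear_Blinfun_apply bounded_linear_fst)

lemma blinfun_apply_dual_e [simp]: "blinfun_apply (dual_e \<nu> i) x = snd x $ \<nu> i"
proof -
  have "bounded_linear (\<lambda>x::'a g_alg. snd x $ \<nu> i)"
    by (rule bounded_linear_compose[OF bounded_linear_vec_nth bounded_linear_snd])
  then show ?thesis unfolding dual_e_def by (simp add: bounded_linear_Blinfun_apply)
qed

lemma finite_labels [simp]: "finite (labels n)"
  by (simp add: labels_def)

lemma linear_coord: "linear (coord n \<nu> p)"
  by (cases p) (auto intro!: linearI simp: blinfun.add_left blinfun.scaleR_left)

lemma coord_basis_vec:
  assumes "bij_betw \<nu> {1..n} (UNIV :: 'n::finite set)" "p \<in> labels n" "q \<in> labels n"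
  shows "coord n \<nu> p (basis_vec n \<nu> q) = (if p = q then 1 else 0)"
proof -
  have inj: "\<nu> i = \<nu> j \<longleftrightarrow> i = j" if "i \<in> {1..n}" "j \<in> {1..n}" for i j
    using assms(1) that by (meson bij_betw_imp_inj_on inj_on_eq_iff)
  show ?thesis
    using assms(2,3)
    by (auto simp: labels_def g_t_def g_e_def axis_def inj zero_prod_def split: if_splits)
qed

lemma bilinear_tri_product: "bilinear (tri_product n \<nu> \<alpha> \<beta>)"
proof -
  have add: "coord n \<nu> p (X + Y) = coord n \<nu> p X + coord n \<nu> p Y" for p X Y
    by (rule linear_add[OF linear_coord])
  have scale: "coord n \<nu> p (r *\<^sub>R X) = r * coord n \<nu> p X" for p r X
    using linear_cmul[OF linear_coord, of n \<nu> p r X] by simp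
  show ?thesis
    unfolding bilinear_def tri_product_def
    by (intro conjI allI linearI;
        simp only: add scale distrib_left distrib_right scaleR_add_left sum.distrib
          scaleR_sum_right scaleR_scaleR mult.assoc mult.left_commute)
qed

lemma tri_product_basis:
  assumes "bij_betw \<nu> {1..n} (UNIV :: 'n::finite set)" "p \<in> labels n" "q \<in> labels n"
  shows "tri_product n \<nu> \<alpha> \<beta> (basis_vec n \<nu> p) (basis_vec n \<nu> q) = basis_product n \<nu> \<alpha> \<beta> p q"
proof -
  have "tri_product n \<nu> \<alpha> \<beta> (basis_vec n \<nu> p) (basis_vec n \<nu> q) =
     (\<Sum>p'\<in>labels n. \<Sum>q'\<in>labels n. if p' = p then (if q' = q then basis_product n \<nu> \<alpha> \<beta> p' q' else 0) else 0)"
    unfolding tri_product_def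
    by (intro sum.cong refl) (auto simp: coord_basis_vec[OF assms(1)] assms)
  also have "\<dots> = (\<Sum>p'\<in>labels n. if p' = p then basis_product n \<nu> \<alpha> \<beta> p' q else 0)"
    by (intro sum.cong refl) (simp add: assms)
  finally show ?thesis by (simp add: assms)
qed

lemma jordan_block0_nth:
  assumes "bij_betw \<nu> {1..n} (UNIV :: 'n::finite set)" "i \<in> {1..n}"
  shows "(jordan_block0 n \<nu> *v v) $ \<nu> i = (if i < n then v $ \<nu> (i + 1) else 0)"
proof -
  have inj: "\<nu> i = \<nu> j \<longleftrightarrow> i = j" if "i \<in> {1..n}" "j \<in> {1..n}" for i j
    using assms(1) that by (meson bij_betw_imp_inj_on inj_on_eq_iff)
  have "jordan_block0 n \<nu> $ \<nu> i $ c = (if i < n \<and> c = \<nu> (i + 1) then 1 else 0)" for c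
  proof -
    have "(\<exists>j. 1 \<le> j \<and> j < n \<and> \<nu> i = \<nu> j \<and> c = \<nu> (j + 1)) \<longleftrightarrow> i < n \<and> c = \<nu> (i + 1)"
    proof
      assume "\<exists>j. 1 \<le> j \<and> j < n \<and> \<nu> i = \<nu> j \<and> c = \<nu> (j + 1)"
      then obtain j where "1 \<le> j" "j < n" "\<nu> i = \<nu> j" "c = \<nu> (j + 1)" by blast
      then show "i < n \<and> c = \<nu> (i + 1)" using inj[of i j] assms(2) by simp
    qed (use assms(2) in auto)
    then show ?thesis by (simp add: jordan_block0_def)
  qed
  then have "(jordan_block0 n \<nu> *v v) $ \<nu> i =
      (\<Sum>c\<in>UNIV. if c = \<nu> (i + 1) then (if i < n then v $ c else 0) else 0)"
    unfolding matrix_vector_mult_def vec_lambda_beta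
    by (intro sum.cong refl) simp
  then show ?thesis by simp
qed

lemma jordan_block0_axis:
  assumes "bij_betw \<nu> {1..n} (UNIV :: 'n::finite set)" "i \<in> {1..n}"
  shows "jordan_block0 n \<nu> *v axis (\<nu> i) 1 = (if i = 1 then 0 else axis (\<nu> (i - 1)) 1)"
proof -
  have inj: "\<nu> i = \<nu> j \<longleftrightarrow> i = j" if "i \<in> {1..n}" "j \<in> {1..n}" for i j
    using assms(1) that by (meson bij_betw_imp_inj_on inj_on_eq_iff)
  have eq: "(jordan_block0 n \<nu> *v axis (\<nu> i) 1) $ \<nu> k = (if i = 1 then 0 else axis (\<nu> (i - 1)) 1) $ \<nu> k"
    if k: "k \<in> {1..n}" for k
  proof -
    have "(jordan_block0 n \<nu> *v axis (\<nu> i) 1) $ \<nu> k = (if i = k + 1 then 1 else 0)"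
      using k assms(2) inj[of "k + 1" i]
      by (auto simp: jordan_block0_nth[OF assms(1) k] axis_def)
    moreover have "(if i = 1 then 0 else axis (\<nu> (i - 1)) 1) $ \<nu> k = (if i = k + 1 then 1 else (0::real))"
    proof (cases "i = 1")
      case False
      then have "i - 1 \<in> {1..n}" using assms(2) by auto
      then have "\<nu> k = \<nu> (i - 1) \<longleftrightarrow> i = k + 1"
        using inj[OF k, of "i - 1"] assms(2) k by (simp, linarith)
      then show ?thesis using False by (auto simp: axis_def)
    qed (use k in simp)
    ultimately show ?thesis by simp
  qed
  show ?thesis
  proof (rule vec_eq_iff[THEN iffD2, rule_format])
    fix r
    have "r \<in> \<nu> ` {1..n}"
      using assms(1) by (simp add: bij_betw_def)
    then obtain k where "r = \<nu> k" "k \<in> {1..n}" by blast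
    then show "(jordan_block0 n \<nu> *v axis (\<nu> i) 1) $ r = (if i = 1 then 0 else axis (\<nu> (i - 1)) 1) $ r"
      using eq by (simp only:)
  qed
qed

lemma g_bracket_basis:
  assumes "bij_betw \<nu> {1..n} (UNIV :: 'n::finite set)" "i \<in> {1..n}" "j \<in> {1..n}"
  shows "g_bracket n \<nu> g_t (g_e \<nu> i) = (if i = 1 then 0 else g_e \<nu> (i - 1))"
    and "g_bracket n \<nu> (g_e \<nu> i) g_t = (if i = 1 then 0 else - g_e \<nu> (i - 1))"
    and "g_bracket n \<nu> (g_e \<nu> i) (g_e \<nu> j) = 0"
  by (auto simp: g_bracket_def g_t_def g_e_def jordan_block0_axis[OF assms(1,2)] zero_prod_def)

lemma blinfun_apply_coad:
  assumes "bilinear br"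
  shows "blinfun_apply (coad br x \<phi>) y = - blinfun_apply \<phi> (br x y)"
proof -
  have "linear (br x)" using assms by (simp add: bilinear_def)
  then have "bounded_linear (br x)" by (rule linear_conv_bounded_linear[THEN iffD1])
  then have "bounded_linear (\<lambda>y. - blinfun_apply \<phi> (br x y))"
    by (intro bounded_linear_minus bounded_linear_compose[OF blinfun.bounded_linear_right])
  then show ?thesis unfolding coad_def by (simp add: bounded_linear_Blinfun_apply)
qed

lemma bilinear_g_bracket: "bilinear (g_bracket n \<nu>)"
  unfolding bilinear_def g_bracket_def
  by (auto intro!: linearI simp: algebra_simps matrix_vector_right_distrib
      matrix_vector_mult_scaleR)

lemma cotangent_bracket_basis:
  assumes "bij_betw \<nu> {1..n} (UNIV :: 'n::finite set)" "i \<in> {1..n-1}"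
  defines "br \<equiv> cotangent_bracket (g_bracket n \<nu>)" and "b \<equiv> basis_vec n \<nu>"
  shows "br (b Lt) (b (Le (i + 1))) = b (Le i)"
    and "br (b Lt) (b (Lf (i + 1))) = - b (Lf i)"
    and "br (b (Le (i + 1))) (b (Lf (n - i + 1))) = b Lz"
proof -
  note coad = blinfun_apply_coad[OF bilinear_g_bracket]
  have i: "1 \<le> i" "i < n" using assms(2) by auto
  have coad0: "coad (g_bracket n \<nu>) x 0 = 0" for x
    by (rule blinfun_eqI) (simp add: coad)
  have coad_zero: "coad (g_bracket n \<nu>) 0 \<phi> = 0" for \<phi>
    by (rule blinfun_eqI) (simp add: coad bilinear_lzero[OF bilinear_g_bracket])
  have br0: "g_bracket n \<nu> x 0 = 0" for x
    by (rule bilinear_rzero[OF bilinear_g_bracket])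
  show "br (b Lt) (b (Le (i + 1))) = b (Le i)"
    using g_bracket_basis(1)[OF assms(1), of "i + 1" 1] i
    by (simp add: br_def b_def cotangent_bracket_def coad0)
  have "coad (g_bracket n \<nu>) g_t (dual_e \<nu> (n - i)) = - dual_e \<nu> (n - i + 1)"
    using jordan_block0_nth[OF assms(1), of "n - i"] i
    by (intro blinfun_eqI) (simp add: coad g_bracket_def g_t_def blinfun.minus_left)
  then show "br (b Lt) (b (Lf (i + 1))) = - b (Lf i)"
    using i by (simp add: br_def b_def cotangent_bracket_def coad_zero br0 Suc_diff_Suc)
  have "coad (g_bracket n \<nu>) (g_e \<nu> (i + 1)) (dual_e \<nu> i) = dual_t"
    using jordan_block0_axis[OF assms(1), of "i + 1"] i
    by (intro blinfun_eqI) (simp add: coad g_bracket_def g_e_def)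
  then show "br (b (Le (i + 1))) (b (Lf (n - i + 1))) = b Lz"
    using i by (simp add: br_def b_def cotangent_bracket_def coad_zero br0 Suc_diff_Suc)
qed

lemma gamma_c_closed_form:
  assumes "\<And>k::int. k \<ge> 1 \<Longrightarrow> of_int k * (\<alpha> - 1) + 1 \<noteq> 0"
    and "\<And>k::int. k \<ge> 1 \<Longrightarrow> of_int k * (\<beta> + 1) - 1 \<noteq> 0"
    and "1 \<le> i" "i < n"
  shows "gamma_c n \<alpha> \<beta> i =
    (\<alpha> - 1) * (real (n - i) * (\<beta> + 1) - 1) / (real n * (\<alpha> - 1) * (\<beta> + 1) - (\<alpha> - 1) + \<beta> + 1)"
proof -
  define a b j where "a = \<alpha> - 1" and "b = \<beta> + 1" and "j = n - i"
  define D E where "D = a * (real i - 1) + 1" and "E = - b * (real j - 1) + 1"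
  have n: "real n = real i + real j" and j: "j \<ge> 1" using assms(3,4) by (auto simp: j_def)
  have D: "D \<noteq> 0"
    using assms(1)[of "int i - 1"] assms(3) by (cases "i = 1") (auto simp: D_def a_def algebra_simps)
  have E: "E \<noteq> 0"
    using assms(2)[of "int j - 1"] j by (cases "j = 1") (auto simp: E_def b_def algebra_simps)
  have al: "alpha_c \<alpha> i = (real i * a + 1) / D" by (simp add: alpha_c_def D_def a_def)
  have be: "beta_c \<beta> j = (real j * b - 1) / E" by (simp add: beta_c_def E_def b_def)
  have num: "alpha_c \<alpha> i * beta_c \<beta> j - beta_c \<beta> j = a * (real j * b - 1) / (D * E)"
    using D E unfolding al be by (simp add: divide_simps) (simp add: D_def algebra_simps)
  have den: "2 * alpha_c \<alpha> i * beta_c \<beta> j + alpha_c \<alpha> i - beta_c \<beta> j = (real n * a * b - a + b) / (D * E)"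
    using D E unfolding al be n by (simp add: divide_simps) (simp add: D_def E_def algebra_simps)
  have "gamma_c n \<alpha> \<beta> i = a * (real j * b - 1) / (real n * a * b - a + b)"
    unfolding gamma_c_def j_def[symmetric] num den using D E by simp
  then show ?thesis by (simp add: a_def b_def j_def algebra_simps)
qed

end

theory Submission
  imports Defs
begin

text \<open>
  In the coordinates dual to \<open>z, e\<^sub>i, f\<^sub>i, t\<close> left symmetry amounts to five scalar identities between
  the structure constants: with \<open>a = \<alpha> - 1\<close>, \<open>b = \<beta> + 1\<close> and \<open>q = n - p + 1\<close> these are
  \<open>\<alpha>\<^sub>p - \<alpha>\<^sub>p\<^sub>+\<^sub>1 = (\<alpha>\<^sub>p - 1) (\<alpha>\<^sub>p\<^sub>+\<^sub>1 - 1)\<close>, \<open>\<beta>\<^sub>p\<^sub>+\<^sub>1 - \<beta>\<^sub>p = (1 + \<beta>\<^sub>p) (1 + \<beta>\<^sub>p\<^sub>+\<^sub>1)\<close>,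
  \<open>\<gamma>\<^sub>p\<^sub>-\<^sub>1 = - \<beta>\<^sub>q \<gamma>\<^sub>p\<close>, \<open>\<gamma>\<^sub>p - 1 = \<alpha>\<^sub>p (\<gamma>\<^sub>p\<^sub>-\<^sub>1 - 1)\<close> and
  \<open>(1 + \<beta>\<^sub>q) \<gamma>\<^sub>p = (\<alpha>\<^sub>p - 1) (\<gamma>\<^sub>p\<^sub>-\<^sub>1 - 1)\<close>, where
  \<open>\<gamma>\<^sub>p = a ((n - p) b - 1) / (n a b - a + b)\<close>.
  The Jacobi identity follows, since the bracket is the commutator of a left-symmetric product.
  For completeness, give \<open>z, e\<^sub>i, f\<^sub>i, t\<close> the weights \<open>0, i, i, n + 1\<close>: right translations
  strictly lower the weight.
\<close>

section \<open>The Lie algebra of a left-symmetric product\<close>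

text \<open>For any bilinear product the Jacobi sum of the commutator is the cyclic sum of the
  left-symmetry defects \<open>d\<close>, so left symmetry delivers the Jacobi identity.\<close>

lemma lie_algebra_commutator:
  fixes pr :: "'a::real_vector \<Rightarrow> 'a \<Rightarrow> 'a"
  assumes bil: "bilinear pr"
    and ls: "\<And>x y z. pr x (pr y z) - pr (pr x y) z = pr y (pr x z) - pr (pr y x) z"
    and br: "\<And>x y. br x y = pr x y - pr y x"
    and fin: "finite B" "span B = (UNIV :: 'a set)"
  shows "lie_algebra br"
proof -
  note dist = bilinear_lsub[OF bil] bilinear_rsub[OF bil] bilinear_ladd[OF bil]
    bilinear_radd[OF bil] bilinear_lmul[OF bil] bilinear_rmul[OF bil]
  have "bilinear br"
    unfolding bilinear_def br by (auto intro!: linearI simp: dist algebra_simps)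
  moreover have "br x (br y z) + br y (br z x) + br z (br x y) = 0" for x y z
  proof -
    define d where "d = (\<lambda>x y z. pr x (pr y z) - pr (pr x y) z - (pr y (pr x z) - pr (pr y x) z))"
    have "br x (br y z) + br y (br z x) + br z (br x y) = d x y z + d y z x + d z x y"
      unfolding br dist d_def by (simp add: algebra_simps)
    then show ?thesis by (simp add: d_def ls)
  qed
  ultimately show ?thesis
    unfolding lie_algebra_def using fin by (auto simp: br)
qed


section \<open>Identities between the structure constants\<close>

text \<open>The numerator of \<open>alpha_c \<alpha> i\<close> exceeds its denominator by
  \<open>\<alpha> - 1\<close>.\<close>

lemma alpha_c_minus_one:
  assumes "\<And>k::int. k \<ge> 1 \<Longrightarrow> of_int k * (\<alpha> - 1) + 1 \<noteq> 0" "i \<ge> 1"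
  shows "alpha_c \<alpha> i - 1 = (\<alpha> - 1) / ((\<alpha> - 1) * (real i - 1) + 1)"
    and "(\<alpha> - 1) * (real i - 1) + 1 \<noteq> 0"
proof -
  \<comment> \<open>The hypothesis at \<open>k = i - 1\<close> covers \<open>i > 1\<close>; at
    \<open>i = 1\<close> the denominator is 1.\<close>
  show nz: "(\<alpha> - 1) * (real i - 1) + 1 \<noteq> 0"
    using assms(1)[of "int i - 1"] assms(2) by (cases "i = 1") (auto simp: mult.commute)
  show "alpha_c \<alpha> i - 1 = (\<alpha> - 1) / ((\<alpha> - 1) * (real i - 1) + 1)"
    using nz unfolding alpha_c_def by (simp add: divide_simps) (simp add: algebra_simps)
qed

lemma beta_c_plus_one:
  assumes "\<And>k::int. k \<ge> 1 \<Longrightarrow> of_int k * (\<beta> + 1) - 1 \<noteq> 0" "i \<ge> 1"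
  shows "1 + beta_c \<beta> i = (\<beta> + 1) / (- (\<beta> + 1) * (real i - 1) + 1)"
    and "- (\<beta> + 1) * (real i - 1) + 1 \<noteq> 0"
proof -
  show nz: "- (\<beta> + 1) * (real i - 1) + 1 \<noteq> 0"
    using assms(1)[of "int i - 1"] assms(2) by (cases "i = 1") (auto simp: algebra_simps)
  show "1 + beta_c \<beta> i = (\<beta> + 1) / (- (\<beta> + 1) * (real i - 1) + 1)"
    using nz unfolding beta_c_def by (simp add: divide_simps) (simp add: algebra_simps)
qed

text \<open>Passing from \<open>i\<close> to \<open>Suc i\<close>, the denominator D of
  \<open>alpha_c \<alpha> i - 1\<close> grows by the numerator \<open>a\<close>, and a/D - a/(D + a)
  = (a/D) * (a/(D + a)).\<close>

lemma alpha_c_Suc: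
  assumes "\<And>k::int. k \<ge> 1 \<Longrightarrow> of_int k * (\<alpha> - 1) + 1 \<noteq> 0" "i \<ge> 1"
  shows "alpha_c \<alpha> i - alpha_c \<alpha> (Suc i) = (alpha_c \<alpha> i - 1) * (alpha_c \<alpha> (Suc i) - 1)"
proof -
  define a where "a = \<alpha> - 1"
  have nz: "a * (real i - 1) + 1 \<noteq> 0" "a * real i + 1 \<noteq> 0"
    using alpha_c_minus_one(2)[OF assms] alpha_c_minus_one(2)[OF assms(1), of "Suc i"]
    by (simp_all add: a_def)
  have eqs: "alpha_c \<alpha> i = 1 + a / (a * (real i - 1) + 1)" "alpha_c \<alpha> (Suc i) = 1 + a / (a * real i + 1)"
    using alpha_c_minus_one(1)[OF assms] alpha_c_minus_one(1)[OF assms(1), of "Suc i"]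
    by (simp_all add: a_def)
  show ?thesis
    unfolding eqs using nz by (simp add: divide_simps) (simp add: algebra_simps)
qed

text \<open>Here the denominators of \<open>1 + beta_c \<beta> i\<close> decrease by the numerator
  \<open>b\<close>, which reverses the difference on the left.\<close>

lemma beta_c_Suc:
  assumes "\<And>k::int. k \<ge> 1 \<Longrightarrow> of_int k * (\<beta> + 1) - 1 \<noteq> 0" "i \<ge> 1"
  shows "beta_c \<beta> (Suc i) - beta_c \<beta> i = (1 + beta_c \<beta> i) * (1 + beta_c \<beta> (Suc i))"
proof -
  define b where "b = \<beta> + 1"
  have nz: "- b * (real i - 1) + 1 \<noteq> 0" "- b * real i + 1 \<noteq> 0"
    using beta_c_plus_one(2)[OF assms] beta_c_plus_one(2)[OF assms(1), of "Suc i"]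
    by (simp_all add: b_def)
  have eqs: "beta_c \<beta> i = b / (- b * (real i - 1) + 1) - 1" "beta_c \<beta> (Suc i) = b / (- b * real i + 1) - 1"
    using beta_c_plus_one(1)[OF assms] beta_c_plus_one(1)[OF assms(1), of "Suc i"]
    by (simp_all add: b_def)
  show ?thesis
    unfolding eqs using nz by (simp add: divide_simps) (simp add: algebra_simps)
qed

text \<open>Over the common denominator \<open>M\<close>, the numerator of
  \<open>gamma_c n \<alpha> \<beta> p\<close> is \<open>- a\<close> times the denominator of
  \<open>beta_c \<beta> q\<close>, and that of \<open>gamma_c n \<alpha> \<beta> (p - 1) - 1\<close>
  is \<open>- b\<close> times the denominator of \<open>alpha_c \<alpha> p\<close>. These factors
  cancel; both sides of the third identity equal \<open>- a * b / M\<close>.\<close>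

lemma gamma_c_identities:
  fixes \<alpha> \<beta> :: real and n p :: nat
  assumes al: "\<And>k::int. k \<ge> 1 \<Longrightarrow> of_int k * (\<alpha> - 1) + 1 \<noteq> 0"
    and be: "\<And>k::int. k \<ge> 1 \<Longrightarrow> of_int k * (\<beta> + 1) - 1 \<noteq> 0"
    and den: "real n * (\<alpha> - 1) * (\<beta> + 1) - \<alpha> + \<beta> + 2 \<noteq> 0"
    and "2 \<le> p" "p < n"
  defines "q \<equiv> n - p + 1"
  shows "gamma_c n \<alpha> \<beta> (p - 1) = - beta_c \<beta> q * gamma_c n \<alpha> \<beta> p"
    and "gamma_c n \<alpha> \<beta> p - 1 = alpha_c \<alpha> p * (gamma_c n \<alpha> \<beta> (p - 1) - 1)"
    and "(1 + beta_c \<beta> q) * gamma_c n \<alpha> \<beta> p = (alpha_c \<alpha> p - 1) * (gamma_c n \<alpha> \<beta> (p - 1) - 1)"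
proof -
  define a b P R where "a = \<alpha> - 1" and "b = \<beta> + 1" and "P = real p" and "R = real n - P"
  have R: "real (n - p) = R" "real (n - (p - 1)) = R + 1" "real n = P + R" "real q = R + 1"
    using assms(4,5) by (auto simp: R_def P_def q_def of_nat_diff)
  define M where "M = (P + R) * a * b - a + b"
  \<comment> \<open>This is \<open>den\<close> in the new variables, since b - a = \<beta> -
    \<alpha> + 2.\<close>
  have M: "M \<noteq> 0" using den by (simp add: M_def a_def b_def R(3) algebra_simps)
  have D: "a * (P - 1) + 1 \<noteq> 0"
    using alpha_c_minus_one(2)[OF al, of p] assms(4) by (simp add: a_def P_def)
  have E: "- b * R + 1 \<noteq> 0"
    using beta_c_plus_one(2)[OF be, of q] by (simp add: b_def R q_def)
  have A: "alpha_c \<alpha> p = (P * a + 1) / (a * (P - 1) + 1)" by (simp add: alpha_c_def a_def P_def)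
  have B: "beta_c \<beta> q = ((R + 1) * b - 1) / (- b * R + 1)"
    by (simp add: beta_c_def b_def R)
  have G: "gamma_c n \<alpha> \<beta> p = a * (R * b - 1) / M" "gamma_c n \<alpha> \<beta> (p - 1) = a * ((R + 1) * b - 1) / M"
    using gamma_c_closed_form[OF al be, of p n] gamma_c_closed_form[OF al be, of "p - 1" n] assms(4,5)
    unfolding M_def R(1,2) by (simp_all add: a_def b_def R(3))
  have G1: "gamma_c n \<alpha> \<beta> p - 1 = - b * (P * a + 1) / M"
    "gamma_c n \<alpha> \<beta> (p - 1) - 1 = - b * (a * (P - 1) + 1) / M"
    unfolding G using M by (simp_all add: divide_simps) (simp_all add: M_def algebra_simps)
  have B1: "1 + beta_c \<beta> q = b / (- b * R + 1)"
    using beta_c_plus_one(1)[OF be, of q] by (simp add: b_def R q_def)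
  have A1: "alpha_c \<alpha> p - 1 = a / (a * (P - 1) + 1)"
    using alpha_c_minus_one(1)[OF al, of p] assms(4) by (simp add: a_def P_def)
  show "gamma_c n \<alpha> \<beta> (p - 1) = - beta_c \<beta> q * gamma_c n \<alpha> \<beta> p"
    unfolding G B using M E by (simp add: divide_simps) (simp add: algebra_simps)
  show "gamma_c n \<alpha> \<beta> p - 1 = alpha_c \<alpha> p * (gamma_c n \<alpha> \<beta> (p - 1) - 1)"
    unfolding G1 A using M D by (simp add: divide_simps)
  show "(1 + beta_c \<beta> q) * gamma_c n \<alpha> \<beta> p = (alpha_c \<alpha> p - 1) * (gamma_c n \<alpha> \<beta> (p - 1) - 1)"
    unfolding B1 A1 G1(2) unfolding G using M D E by (simp add: divide_simps) (simp add: algebra_simps)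
qed


section \<open>Coordinates\<close>

lemma ball_labels:
  "(\<forall>p\<in>labels n. P p) \<longleftrightarrow> P Lz \<and> P Lt \<and> (\<forall>i\<in>{1..n}. P (Le i)) \<and> (\<forall>i\<in>{1..n}. P (Lf i))"
  by (auto simp: labels_def)

text \<open>Indices appear as \<open>Suc j\<close> because the equations of
  \<open>basis_product\<close> match on \<open>Suc\<close>.\<close>

lemma sum_labels:
  fixes g :: "label \<Rightarrow> 'b::comm_monoid_add"
  shows "sum g (labels n) = g Lz + g Lt + (\<Sum>j<n. g (Le (Suc j))) + (\<Sum>j<n. g (Lf (Suc j)))"
proof -
  have "sum g (labels n) = sum g {Lz, Lt} + sum g (Le ` {1..n}) + sum g (Lf ` {1..n})"
  proof -
    have "sum g (labels n) = sum g ({Lz, Lt} \<union> Le ` {1..n}) + sum g (Lf ` {1..n})"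
      unfolding labels_def by (rule sum.union_disjoint) auto
    also have "sum g ({Lz, Lt} \<union> Le ` {1..n}) = sum g {Lz, Lt} + sum g (Le ` {1..n})"
      by (rule sum.union_disjoint) auto
    finally show ?thesis .
  qed
  moreover have "sum g (h ` {1..n}) = (\<Sum>j<n. g (h (Suc j)))" if "inj h" for h :: "nat \<Rightarrow> label"
  proof -
    have "sum g (h ` {1..n}) = sum (g \<circ> h) {1..n}"
      using that by (intro sum.reindex) (auto simp: inj_on_def)
    also have "\<dots> = (\<Sum>j<n. g (h (Suc j)))"
      by (rule sum.reindex_bij_witness[of _ Suc "\<lambda>i. i - 1"]) auto
    finally show ?thesis .
  qed
  ultimately show ?thesis by (simp add: inj_def)
qed

lemma g_alg_expansion:
  assumes "bij_betw \<nu> {1..n} (UNIV :: 'n::finite set)"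
  shows "(x :: 'n g_alg) = fst x *\<^sub>R g_t + (\<Sum>i\<in>{1..n}. (snd x $ \<nu> i) *\<^sub>R g_e \<nu> i)"
proof -
  have "snd x = (\<Sum>r\<in>UNIV. (snd x $ r) *\<^sub>R axis r 1)"
    using basis_expansion[of "snd x"] by (simp add: scalar_mult_eq_scaleR)
  also have "\<dots> = (\<Sum>i\<in>{1..n}. (snd x $ \<nu> i) *\<^sub>R axis (\<nu> i) 1)"
    by (rule sum.reindex_bij_betw[OF assms, symmetric])
  finally show ?thesis
    by (simp add: prod_eq_iff g_t_def g_e_def fst_sum snd_sum)
qed

text \<open>A functional is determined by its values on \<open>g_t\<close> and the
  \<open>g_e \<nu> i\<close>. This reduces identities between vectors to identities between real
  coordinates.\<close>

lemma Tg_eqI: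
  fixes X Y :: "'n::finite Tg_alg"
  assumes bij: "bij_betw \<nu> {1..n} (UNIV :: 'n set)"
    and eq: "\<And>p. p \<in> labels n \<Longrightarrow> coord n \<nu> p X = coord n \<nu> p Y"
  shows "X = Y"
proof -
  have t: "fst (fst X) = fst (fst Y)" using eq[of Lt] by (simp add: labels_def)
  have z: "snd X g_t = snd Y g_t" using eq[of Lz] by (simp add: labels_def)
  have e: "snd (fst X) $ \<nu> i = snd (fst Y) $ \<nu> i" if "i \<in> {1..n}" for i
    using eq[of "Le i"] that by (simp add: labels_def)
  \<comment> \<open>The reversal i \<mapsto> n - i + 1 is an involution of 1..n, so the
    \<open>Lf\<close> coordinates cover all these values.\<close>
  have f: "snd X (g_e \<nu> i) = snd Y (g_e \<nu> i)" if "i \<in> {1..n}" for i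
    using eq[of "Lf (n - i + 1)"] that by (auto simp: labels_def)
  have "fst X = fst Y"
    using g_alg_expansion[OF bij, of "fst X"] g_alg_expansion[OF bij, of "fst Y"] t e
    by (metis (no_types, lifting) sum.cong)
  moreover have "snd X = snd Y"
  proof (rule blinfun_eqI)
    fix x :: "'n g_alg"
    show "snd X x = snd Y x"
      by (subst (1 2) g_alg_expansion[OF bij, of x])
        (simp add: blinfun.add_right blinfun.sum_right blinfun.scaleR_right z f)
  qed
  ultimately show ?thesis by (simp add: prod_eq_iff)
qed

text \<open>Supplies the finite spanning set required by \<open>lie_algebra\<close>.\<close>

lemma span_basis_vec:
  assumes bij: "bij_betw \<nu> {1..n} (UNIV :: 'n::finite set)"
  shows "span (basis_vec n \<nu> ` labels n) = (UNIV :: 'n Tg_alg set)"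
proof -
  have "X \<in> span (basis_vec n \<nu> ` labels n)" for X :: "'n Tg_alg"
  proof -
    have "X = (\<Sum>p\<in>labels n. coord n \<nu> p X *\<^sub>R basis_vec n \<nu> p)"
      by (rule Tg_eqI[OF bij])
        (simp add: linear_sum[OF linear_coord] linear_cmul[OF linear_coord] coord_basis_vec[OF bij]
          if_distrib cong: if_cong)
    also have "\<dots> \<in> span (basis_vec n \<nu> ` labels n)"
      by (intro span_sum span_scale span_base) auto
    finally show ?thesis .
  qed
  then show ?thesis by auto
qed

lemma tri_product_expansion:
  fixes n :: nat and \<nu> :: "nat \<Rightarrow> 'n::finite" and X Y :: "'n Tg_alg"
  defines "c \<equiv> coord n \<nu>" and "b \<equiv> basis_vec n \<nu>"
  shows "tri_product n \<nu> \<alpha> \<beta> X Y = (\<Sum>i\<in>{1..n-1}.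
     (alpha_c \<alpha> i * c Lt X * c (Le (i+1)) Y + (alpha_c \<alpha> i - 1) * c (Le (i+1)) X * c Lt Y) *\<^sub>R b (Le i) +
     (beta_c \<beta> i * c Lt X * c (Lf (i+1)) Y + (1 + beta_c \<beta> i) * c (Lf (i+1)) X * c Lt Y) *\<^sub>R b (Lf i) +
     (gamma_c n \<alpha> \<beta> i * c (Le (i+1)) X * c (Lf (n-i+1)) Y
        + (gamma_c n \<alpha> \<beta> i - 1) * c (Lf (n-i+1)) X * c (Le (i+1)) Y) *\<^sub>R b Lz)"
proof -
  have *: "(\<Sum>j<n. r j *\<^sub>R (if j \<in> {1..n-1} then v j else 0)) = (\<Sum>j\<in>{1..n-1}. r j *\<^sub>R v j)"
    for r and v :: "nat \<Rightarrow> 'n Tg_alg"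
    by (rule sum.mono_neutral_cong_right) auto
  \<comment> \<open>For fixed \<open>i\<close> only \<open>j = n - i\<close> contributes; it lies in
    the range of summation because \<open>i \<ge> 1\<close>.\<close>
  have **: "(\<Sum>i<n. \<Sum>j<n. r i j *\<^sub>R (if i \<in> {1..n-1} \<and> j = n - i then v i else 0))
      = (\<Sum>i\<in>{1..n-1}. r i (n - i) *\<^sub>R v i)"
    for r and v :: "nat \<Rightarrow> 'n Tg_alg"
  proof -
    have "(\<Sum>j<n. r i j *\<^sub>R (if i \<in> {1..n-1} \<and> j = n - i then v i else 0))
      = r i (n - i) *\<^sub>R (if i \<in> {1..n-1} then v i else 0)" for i
    proof (cases "i \<in> {1..n-1}")
      case True
      then have "n - i < n" by auto
      then show ?thesis using True by (simp add: if_distrib cong: if_cong)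
    qed auto
    then show ?thesis by (simp only: *)
  qed
  have ***: "(\<Sum>i<n. \<Sum>j<n. r i j *\<^sub>R (if j \<in> {1..n-1} \<and> i = n - j then v j else 0))
      = (\<Sum>j\<in>{1..n-1}. r (n - j) j *\<^sub>R v j)"
    for r and v :: "nat \<Rightarrow> 'n Tg_alg"
    by (subst sum.swap) (rule **)
  have "tri_product n \<nu> \<alpha> \<beta> X Y =
      (\<Sum>i\<in>{1..n-1}. (c Lt X * c (Le (Suc i)) Y) *\<^sub>R alpha_c \<alpha> i *\<^sub>R b (Le i)) +
      (\<Sum>i\<in>{1..n-1}. (c Lt X * c (Lf (Suc i)) Y) *\<^sub>R beta_c \<beta> i *\<^sub>R b (Lf i)) +
      (\<Sum>i\<in>{1..n-1}. (c (Le (Suc i)) X * c Lt Y) *\<^sub>R (- 1 + alpha_c \<alpha> i) *\<^sub>R b (Le i)) +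
      (\<Sum>i\<in>{1..n-1}. (c (Le (Suc i)) X * c (Lf (Suc (n - i))) Y) *\<^sub>R gamma_c n \<alpha> \<beta> i *\<^sub>R b Lz) +
      (\<Sum>i\<in>{1..n-1}. (c (Lf (Suc i)) X * c Lt Y) *\<^sub>R (1 + beta_c \<beta> i) *\<^sub>R b (Lf i)) +
      (\<Sum>i\<in>{1..n-1}. (c (Lf (Suc (n - i))) X * c (Le (Suc i)) Y) *\<^sub>R (- 1 + gamma_c n \<alpha> \<beta> i) *\<^sub>R b Lz)"
    unfolding tri_product_def sum_labels c_def[symmetric] b_def
    by (simp only: basis_product.simps scaleR_zero_right sum.neutral_const add_0_left add_0_right
        sum.distrib * ** *** add.assoc)
  then show ?thesis
    by (simp add: sum.distrib[symmetric] algebra_simps cong: sum.cong_simp)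
qed

text \<open>Serves the \<open>Lz\<close> coordinate of a double product: the two boundary terms
  vanish there because no product has an \<open>Le n\<close> or \<open>Lf n\<close>
  coordinate.\<close>

lemma sum_shift_second:
  fixes n :: nat and U V :: "nat \<Rightarrow> 'a::comm_monoid_add"
  assumes "n \<ge> 2" "U 1 = 0" "V (n - 1) = 0"
  shows "(\<Sum>i\<in>{1..n-1}. U i + V i) = (\<Sum>p\<in>{2..n-1}. U p + V (p - 1))"
proof -
  have "(\<Sum>i\<in>{1..n-1}. U i) = (\<Sum>p\<in>{2..n-1}. U p)"
  proof -
    have "{1..n-1} = insert 1 {2..n-1}" using assms(1) by auto
    then show ?thesis using assms(2) by simp
  qed
  moreover have "(\<Sum>i\<in>{1..n-1}. V i) = (\<Sum>i\<in>{1..n-2}. V i)"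
  proof -
    have "{1..n-1} = insert (n - 1) {1..n-2}" using assms(1) by auto
    moreover have "n - 1 \<notin> {1..n-2}" using assms(1) by auto
    ultimately show ?thesis using assms(3) by simp
  qed
  moreover have "(\<Sum>i\<in>{1..n-2}. V i) = (\<Sum>p\<in>{2..n-1}. V (p - 1))"
    by (rule sum.reindex_bij_witness[of _ "\<lambda>p. p - 1" "\<lambda>i. i + 1"]) auto
  ultimately show ?thesis by (simp add: sum.distrib)
qed

section \<open>Product and bracket in coordinates\<close>

context
  fixes n :: nat and \<nu> :: "nat \<Rightarrow> 'n::finite"
  assumes bij: "bij_betw \<nu> {1..n} (UNIV :: 'n set)"
begin

abbreviation "c \<equiv> coord n \<nu>"

lemma coord_tri_product:
  shows "c Lt (tri_product n \<nu> \<alpha> \<beta> X Y) = 0"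
    and "i \<in> {1..n} \<Longrightarrow> c (Le i) (tri_product n \<nu> \<alpha> \<beta> X Y) = (if i < n then
      alpha_c \<alpha> i * c Lt X * c (Le (i+1)) Y + (alpha_c \<alpha> i - 1) * c (Le (i+1)) X * c Lt Y else 0)"
    and "i \<in> {1..n} \<Longrightarrow> c (Lf i) (tri_product n \<nu> \<alpha> \<beta> X Y) = (if i < n then
      beta_c \<beta> i * c Lt X * c (Lf (i+1)) Y + (1 + beta_c \<beta> i) * c (Lf (i+1)) X * c Lt Y else 0)"
    and "c Lz (tri_product n \<nu> \<alpha> \<beta> X Y) = (\<Sum>i\<in>{1..n-1}.
      gamma_c n \<alpha> \<beta> i * c (Le (i+1)) X * c (Lf (n-i+1)) Y
        + (gamma_c n \<alpha> \<beta> i - 1) * c (Lf (n-i+1)) X * c (Le (i+1)) Y)"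
proof -
  have *: "(\<Sum>j\<in>{1..n-1}. g j * (if j = i then 1 else 0)) = (if i < n then g i else 0)"
    if "i \<in> {1..n}" for i and g :: "nat \<Rightarrow> real"
  proof -
    have "(\<Sum>j\<in>{1..n-1}. g j * (if j = i then 1 else 0)) = (\<Sum>j\<in>{1..n-1}. if j = i then g j else 0)"
      by (rule sum.cong) auto
    then show ?thesis using that by auto
  qed
  have cb: "c p (basis_vec n \<nu> q) = (if q = p then 1 else 0)" if "p \<in> labels n" "q \<in> labels n" for p q
    using coord_basis_vec[OF bij that] by auto
  have lab: "Lt \<in> labels n" "Lz \<in> labels n" "\<And>i. Le i \<in> labels n \<longleftrightarrow> i \<in> {1..n}"
    "\<And>i. Lf i \<in> labels n \<longleftrightarrow> i \<in> {1..n}" by (auto simp: labels_def)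
  have sub: "j \<in> {1..n}" if "j \<in> {1..n-1}" for j using that by auto
  have main: "c p (tri_product n \<nu> \<alpha> \<beta> X Y) = (\<Sum>i\<in>{1..n-1}.
     (alpha_c \<alpha> i * c Lt X * c (Le (i+1)) Y + (alpha_c \<alpha> i - 1) * c (Le (i+1)) X * c Lt Y) * (if Le i = p then 1 else 0) +
     (beta_c \<beta> i * c Lt X * c (Lf (i+1)) Y + (1 + beta_c \<beta> i) * c (Lf (i+1)) X * c Lt Y) * (if Lf i = p then 1 else 0) +
     (gamma_c n \<alpha> \<beta> i * c (Le (i+1)) X * c (Lf (n-i+1)) Y
        + (gamma_c n \<alpha> \<beta> i - 1) * c (Lf (n-i+1)) X * c (Le (i+1)) Y) * (if Lz = p then 1 else 0))"
    if "p \<in> labels n" for p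
    unfolding tri_product_expansion linear_sum[OF linear_coord]
    by (rule sum.cong[OF refl])
      (simp only: linear_add[OF linear_coord] linear_cmul[OF linear_coord] cb that lab sub real_scaleR_def)
  show "c Lt (tri_product n \<nu> \<alpha> \<beta> X Y) = 0"
    by (subst main) (simp_all add: lab)
  show "c Lz (tri_product n \<nu> \<alpha> \<beta> X Y) = (\<Sum>i\<in>{1..n-1}.
      gamma_c n \<alpha> \<beta> i * c (Le (i+1)) X * c (Lf (n-i+1)) Y
        + (gamma_c n \<alpha> \<beta> i - 1) * c (Lf (n-i+1)) X * c (Le (i+1)) Y)"
    by (subst main) (simp_all add: lab del: coord.simps)
  show "c (Le i) (tri_product n \<nu> \<alpha> \<beta> X Y) = (if i < n then
      alpha_c \<alpha> i * c Lt X * c (Le (i+1)) Y + (alpha_c \<alpha> i - 1) * c (Le (i+1)) X * c Lt Y else 0)"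
    if "i \<in> {1..n}"
    by (subst main) (simp_all only: lab that label.simps if_False mult_zero_right add_0_right *)
  show "c (Lf i) (tri_product n \<nu> \<alpha> \<beta> X Y) = (if i < n then
      beta_c \<beta> i * c Lt X * c (Lf (i+1)) Y + (1 + beta_c \<beta> i) * c (Lf (i+1)) X * c Lt Y else 0)"
    if "i \<in> {1..n}"
    by (subst main) (simp_all only: lab that label.simps if_False mult_zero_right add_0_right add_0_left *)
qed

lemma coord_cotangent_bracket:
  fixes X Y :: "'n Tg_alg"
  defines "br \<equiv> cotangent_bracket (g_bracket n \<nu>)"
  shows "c Lt (br X Y) = 0"
    and "i \<in> {1..n} \<Longrightarrow> c (Le i) (br X Y) =
      (if i < n then c Lt X * c (Le (i+1)) Y - c (Le (i+1)) X * c Lt Y else 0)"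
    and "i \<in> {1..n} \<Longrightarrow> c (Lf i) (br X Y) =
      (if i < n then c (Lf (i+1)) X * c Lt Y - c Lt X * c (Lf (i+1)) Y else 0)"
    and "c Lz (br X Y) = (\<Sum>i\<in>{1..n-1}.
      c (Le (i+1)) X * c (Lf (n-i+1)) Y - c (Lf (n-i+1)) X * c (Le (i+1)) Y)"
proof -
  note coad = blinfun_apply_coad[OF bilinear_g_bracket]
  show "c Lt (br X Y) = 0"
    by (simp add: br_def cotangent_bracket_def g_bracket_def)
  show "c (Le i) (br X Y) =
      (if i < n then c Lt X * c (Le (i+1)) Y - c (Le (i+1)) X * c Lt Y else 0)" if "i \<in> {1..n}"
    using jordan_block0_nth[OF bij that]
    by (simp add: br_def cotangent_bracket_def g_bracket_def mult.commute)
  \<comment> \<open>The \<open>Lz\<close> coordinate evaluates the coadjoint terms at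
    \<open>g_t\<close>, hence the functionals at brackets with \<open>g_t\<close>.\<close>
  have gt: "g_bracket n \<nu> x g_t = - (\<Sum>i\<in>{1..n-1}. (snd x $ \<nu> (i+1)) *\<^sub>R g_e \<nu> i)" for x
  proof -
    have "g_bracket n \<nu> x g_t =
        (\<Sum>i\<in>{1..n}. (snd (g_bracket n \<nu> x g_t) $ \<nu> i) *\<^sub>R g_e \<nu> i)"
      by (subst g_alg_expansion[OF bij]) (simp add: g_bracket_def)
    also have "\<dots> = (\<Sum>i\<in>{1..n}. - ((if i < n then snd x $ \<nu> (i+1) else 0) *\<^sub>R g_e \<nu> i))"
      by (rule sum.cong) (auto simp: g_bracket_def g_t_def jordan_block0_nth[OF bij])
    also have "\<dots> = (\<Sum>i\<in>{1..n-1}. - ((snd x $ \<nu> (i+1)) *\<^sub>R g_e \<nu> i))"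
      by (rule sum.mono_neutral_cong_right) auto
    finally show ?thesis by (simp add: sum_negf)
  qed
  have ge: "g_bracket n \<nu> x (g_e \<nu> k) = (if k = 1 then 0 else fst x *\<^sub>R g_e \<nu> (k - 1))"
    if "k \<in> {1..n}" for x k
    using jordan_block0_axis[OF bij that] by (simp add: g_bracket_def g_e_def zero_prod_def)
  show "c (Lf i) (br X Y) =
      (if i < n then c (Lf (i+1)) X * c Lt Y - c Lt X * c (Lf (i+1)) Y else 0)" if "i \<in> {1..n}"
  proof -
    \<comment> \<open>Because of the reversed numbering, lowering the index of \<open>g_e\<close> by
      one raises that of \<open>Lf\<close> by one; the bracket with \<open>g_e \<nu> 1\<close> is
      the case \<open>i = n\<close>.\<close>
    have "n - i + 1 \<in> {1..n}" "n - i + 1 = 1 \<longleftrightarrow> \<not> i < n" "i < n \<Longrightarrow> n - i + 1 - 1 = n - (i+1) + 1"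
      using that by auto
    then show ?thesis
      by (simp add: br_def cotangent_bracket_def coad ge blinfun.diff_left blinfun.scaleR_right)
  qed
  have "c Lz (br X Y) = (\<Sum>i\<in>{1..n-1}. snd (fst X) $ \<nu> (i+1) * snd Y (g_e \<nu> i))
      - (\<Sum>i\<in>{1..n-1}. snd (fst Y) $ \<nu> (i+1) * snd X (g_e \<nu> i))"
    by (simp add: br_def cotangent_bracket_def coad gt blinfun.diff_left blinfun.minus_right
        blinfun.sum_right blinfun.scaleR_right)
  also have "\<dots> = (\<Sum>i\<in>{1..n-1}.
      c (Le (i+1)) X * c (Lf (n-i+1)) Y - c (Lf (n-i+1)) X * c (Le (i+1)) Y)"
    unfolding sum_subtractf[symmetric]
  proof (rule sum.cong[OF refl])
    fix i assume "i \<in> {1..n-1}"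
    then have "n - (n - i + 1) + 1 = i" by auto
    then show "snd (fst X) $ \<nu> (i+1) * snd Y (g_e \<nu> i) - snd (fst Y) $ \<nu> (i+1) * snd X (g_e \<nu> i) =
      c (Le (i+1)) X * c (Lf (n-i+1)) Y - c (Lf (n-i+1)) X * c (Le (i+1)) Y"
      by (simp only: coord.simps mult.commute)
  qed
  finally show "c Lz (br X Y) = (\<Sum>i\<in>{1..n-1}.
      c (Le (i+1)) X * c (Lf (n-i+1)) Y - c (Lf (n-i+1)) X * c (Le (i+1)) Y)" .
qed

text \<open>The structure constants cancel in pairs:
  \<open>\<alpha>\<^sub>i - (\<alpha>\<^sub>i - 1) = 1\<close>,
  \<open>\<beta>\<^sub>i - (1 + \<beta>\<^sub>i) = - 1\<close> and
  \<open>\<gamma>\<^sub>i - (\<gamma>\<^sub>i - 1) = 1\<close>.\<close>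

lemma cotangent_bracket_eq_commutator:
  "cotangent_bracket (g_bracket n \<nu>) X Y = tri_product n \<nu> \<alpha> \<beta> X Y - tri_product n \<nu> \<alpha> \<beta> Y X"
proof (rule Tg_eqI[OF bij])
  fix p assume "p \<in> labels n"
  moreover have "\<forall>p\<in>labels n. c p (cotangent_bracket (g_bracket n \<nu>) X Y) =
      c p (tri_product n \<nu> \<alpha> \<beta> X Y) - c p (tri_product n \<nu> \<alpha> \<beta> Y X)"
    unfolding ball_labels
    by (auto simp: coord_tri_product coord_cotangent_bracket sum_subtractf[symmetric] algebra_simps
        simp del: coord.simps intro!: sum.cong)
  ultimately show "c p (cotangent_bracket (g_bracket n \<nu>) X Y) =
      c p (tri_product n \<nu> \<alpha> \<beta> X Y - tri_product n \<nu> \<alpha> \<beta> Y X)"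
    by (simp add: linear_diff[OF linear_coord])
qed

section \<open>Left symmetry\<close>

lemma tri_product_left_symmetric:
  fixes \<alpha> \<beta> :: real
  assumes "n \<ge> 2"
    and al: "\<And>k::int. k \<ge> 1 \<Longrightarrow> of_int k * (\<alpha> - 1) + 1 \<noteq> 0"
    and be: "\<And>k::int. k \<ge> 1 \<Longrightarrow> of_int k * (\<beta> + 1) - 1 \<noteq> 0"
    and den: "real n * (\<alpha> - 1) * (\<beta> + 1) - \<alpha> + \<beta> + 2 \<noteq> 0"
  defines "m \<equiv> tri_product n \<nu> \<alpha> \<beta>"
  shows "m X (m Y Z) - m (m X Y) Z = m Y (m X Z) - m (m Y X) Z"
proof (rule Tg_eqI[OF bij])
  let ?A = "alpha_c \<alpha>" and ?B = "beta_c \<beta>" and ?G = "gamma_c n \<alpha> \<beta>"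
  note cm = coord_tri_product[where \<alpha>=\<alpha> and \<beta>=\<beta>, folded m_def]
  have e: "c (Le i) (m X (m Y Z)) - c (Le i) (m (m X Y) Z) = c (Le i) (m Y (m X Z)) - c (Le i) (m (m Y X) Z)"
    if i: "i \<in> {1..n}" for i
  proof (cases "i + 1 < n")
    case True
    \<comment> \<open>Terms containing the \<open>Lt\<close> coordinates of both \<open>X\<close>
      and \<open>Y\<close> cancel by symmetry; \<open>r\<close> kills the coefficient of what is
      left.\<close>
    have r: "?A i - ?A (i+1) = (?A i - 1) * (?A (i+1) - 1)"
      using alpha_c_Suc[OF al, of i] i by simp
    have i': "i + 1 \<in> {1..n}" "i < n" using True by auto
    show ?thesis
      unfolding cm(1) cm(2)[OF i] cm(2)[OF i'(1)] if_P[OF True] if_P[OF i'(2)]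
      using r by algebra
  next
    \<comment> \<open>For \<open>i \<ge> n - 1\<close> all four terms vanish, since products have no
      \<open>Le n\<close> or \<open>Lt\<close> coordinate.\<close>
    case False
    then have "i < n \<Longrightarrow> i + 1 = n" by auto
    then show ?thesis using i assms(1) by (cases "i < n") (auto simp: cm simp del: coord.simps)
  qed
  have f: "c (Lf i) (m X (m Y Z)) - c (Lf i) (m (m X Y) Z) = c (Lf i) (m Y (m X Z)) - c (Lf i) (m (m Y X) Z)"
    if i: "i \<in> {1..n}" for i
  proof (cases "i + 1 < n")
    case True
    have r: "?B (i+1) - ?B i = (1 + ?B i) * (1 + ?B (i+1))"
      using beta_c_Suc[OF be, of i] i by simp
    have i': "i + 1 \<in> {1..n}" "i < n" using True by auto
    show ?thesis
      unfolding cm(1) cm(3)[OF i] cm(3)[OF i'(1)] if_P[OF True] if_P[OF i'(2)]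
      using r by algebra
  next
    case False
    then have "i < n \<Longrightarrow> i + 1 = n" by auto
    then show ?thesis using i assms(1) by (cases "i < n") (auto simp: cm simp del: coord.simps)
  qed
  \<comment> \<open>After the shift by one both summands involve the same coordinates \<open>p + 1\<close> of \<open>e\<close> and \<open>n - p + 2\<close> of \<open>f\<close>,
    so the identity holds term by term.\<close>
  have zl: "c Lz (m X (m Y Z)) = (\<Sum>p\<in>{2..n-1}. ?G p * c (Le (p+1)) X * c (Lf (n-p+1)) (m Y Z)
        + (?G (p-1) - 1) * c (Lf (n-(p-1)+1)) X * c (Le (p-1+1)) (m Y Z))" for X Y Z
    unfolding cm(4)[of X "m Y Z"]
    by (rule sum_shift_second) (use assms(1) in \<open>simp_all add: cm del: coord.simps\<close>)
  \<comment> \<open>The summands are exchanged first, so that again the one with the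
    \<open>Lf\<close> coordinate of the inner product stays and the one with its \<open>Le\<close>
    coordinate is shifted.\<close>
  have zr: "c Lz (m (m X Y) Z) = (\<Sum>p\<in>{2..n-1}. (?G p - 1) * c (Lf (n-p+1)) (m X Y) * c (Le (p+1)) Z
        + ?G (p-1) * c (Le (p-1+1)) (m X Y) * c (Lf (n-(p-1)+1)) Z)" for X Y Z
    unfolding cm(4)[of "m X Y" Z]
    by (subst add.commute, rule sum_shift_second) (use assms(1) in \<open>simp_all add: cm del: coord.simps\<close>)
  have z: "c Lz (m X (m Y Z)) - c Lz (m (m X Y) Z) = c Lz (m Y (m X Z)) - c Lz (m (m Y X) Z)"
    unfolding zl zr sum_subtractf[symmetric]
  proof (rule sum.cong[OF refl])
    fix p assume p: "p \<in> {2..n-1}"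
    define q where "q = n - p + 1"
    have q: "n - p + 1 = q" "n - (p - 1) + 1 = q + 1" "p - 1 + 1 = p"
      "q \<in> {1..n}" "p \<in> {1..n}" "q < n" "p < n"
      using p by (auto simp: q_def)
    \<comment> \<open>After antisymmetrization in \<open>X\<close> and \<open>Y\<close>,
      \<open>i1\<close>, \<open>i2\<close> and \<open>i3\<close> kill the monomials to which
      \<open>Z\<close> contributes its \<open>Lf\<close>, \<open>Le\<close> and \<open>Lt\<close>
      coordinate, respectively.\<close>
    have i1: "?G (p - 1) = - ?B q * ?G p"
      and i2: "?G p - 1 = ?A p * (?G (p - 1) - 1)"
      and i3: "(1 + ?B q) * ?G p = (?A p - 1) * (?G (p - 1) - 1)"
      using gamma_c_identities[OF al be den, of p] p unfolding q_def by auto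
    show "?G p * c (Le (p+1)) X * c (Lf (n-p+1)) (m Y Z)
        + (?G (p-1) - 1) * c (Lf (n-(p-1)+1)) X * c (Le (p-1+1)) (m Y Z)
        - ((?G p - 1) * c (Lf (n-p+1)) (m X Y) * c (Le (p+1)) Z
        + ?G (p-1) * c (Le (p-1+1)) (m X Y) * c (Lf (n-(p-1)+1)) Z)
      = ?G p * c (Le (p+1)) Y * c (Lf (n-p+1)) (m X Z)
        + (?G (p-1) - 1) * c (Lf (n-(p-1)+1)) Y * c (Le (p-1+1)) (m X Z)
        - ((?G p - 1) * c (Lf (n-p+1)) (m Y X) * c (Le (p+1)) Z
        + ?G (p-1) * c (Le (p-1+1)) (m Y X) * c (Lf (n-(p-1)+1)) Z)"
      unfolding q(1-3) cm(2)[OF q(5)] cm(3)[OF q(4)] if_P[OF q(6)] if_P[OF q(7)]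
      using i1 i2 i3 by algebra
  qed
  fix p assume "p \<in> labels n"
  moreover have "\<forall>p\<in>labels n. c p (m X (m Y Z)) - c p (m (m X Y) Z) = c p (m Y (m X Z)) - c p (m (m Y X) Z)"
    unfolding ball_labels using e f z by (simp add: cm(1) del: coord.simps)
  ultimately show "c p (m X (m Y Z) - m (m X Y) Z) = c p (m Y (m X Z) - m (m Y X) Z)"
    by (simp add: linear_diff[OF linear_coord])
qed

section \<open>Completeness\<close>

lemma nilpotent_right_translation:
  "nilpotent_endomorphism (\<lambda>Y. tri_product n \<nu> \<alpha> \<beta> Y X)"
proof -
  let ?r = "\<lambda>Y. tri_product n \<nu> \<alpha> \<beta> Y X"
  define wt where "wt = (\<lambda>p. case p of Lz \<Rightarrow> 0 | Le i \<Rightarrow> i | Lf i \<Rightarrow> i | Lt \<Rightarrow> n + 1)"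
  \<comment> \<open>After \<open>k\<close> applications only coordinates of weight at most n + 1 - k
    survive; the additive form avoids truncated subtraction.\<close>
  have vanish: "\<forall>p\<in>labels n. n + 1 < wt p + k \<longrightarrow> c p ((?r ^^ k) Y) = 0" for k Y
  proof (induction k)
    case 0
    show ?case by (auto simp: labels_def wt_def)
  next
    case (Suc k)
    then have IH: "n + 1 < n + 1 + k \<Longrightarrow> c Lt ((?r ^^ k) Y) = 0"
      "\<And>i. i \<in> {1..n} \<Longrightarrow> n + 1 < i + k \<Longrightarrow> c (Le i) ((?r ^^ k) Y) = 0"
      "\<And>i. i \<in> {1..n} \<Longrightarrow> n + 1 < i + k \<Longrightarrow> c (Lf i) ((?r ^^ k) Y) = 0"
      unfolding ball_labels by (auto simp: wt_def simp del: coord.simps)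
    \<comment> \<open>Index \<open>i\<close> of the image draws only on index \<open>i + 1\<close>
      and on \<open>Lt\<close>, and \<open>Lz\<close> only on indices at least 2, all of larger
      weight.\<close>
    show ?case
      unfolding ball_labels funpow.simps comp_def
      by (auto simp: wt_def coord_tri_product IH simp del: coord.simps intro!: sum.neutral)
  qed
  \<comment> \<open>The weights run from 0 to n + 1, so n + 2 applications exhaust them.\<close>
  have "(?r ^^ (n + 2)) Y = 0" for Y
  proof (rule Tg_eqI[OF bij])
    show "c p ((?r ^^ (n + 2)) Y) = c p 0" if "p \<in> labels n" for p
      using vanish[of "n + 2" Y] that linear_0[OF linear_coord, of n \<nu> p] by auto
  qed
  moreover have "linear ?r"
    using bilinear_tri_product[of n \<nu> \<alpha> \<beta>] unfolding bilinear_def by blast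
  ultimately show ?thesis
    unfolding nilpotent_endomorphism_def by blast
qed

end

theorem lemma3p1:
  fixes n :: nat and \<nu> :: "nat \<Rightarrow> 'n::finite" and \<alpha> \<beta> :: real
  assumes "n \<ge> 2"
    and "bij_betw \<nu> {1..n} (UNIV :: 'n set)"
    and "\<And>k::int. k \<ge> 1 \<Longrightarrow> of_int k * (\<alpha> - 1) + 1 \<noteq> 0"
    and "\<And>k::int. k \<ge> 1 \<Longrightarrow> of_int k * (\<beta> + 1) - 1 \<noteq> 0"
    and "real n * (\<alpha> - 1) * (\<beta> + 1) - \<alpha> + \<beta> + 2 \<noteq> 0"
  shows "complete_left_symmetric_structure
           (cotangent_bracket (g_bracket n \<nu>)) (tri_product n \<nu> \<alpha> \<beta>)"
proof -
  note ls = tri_product_left_symmetric[OF assms(2,1,3-5)]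
  note comm = cotangent_bracket_eq_commutator[OF assms(2), of _ _ \<alpha> \<beta>]
  have "lie_algebra (cotangent_bracket (g_bracket n \<nu>))"
    by (rule lie_algebra_commutator[OF bilinear_tri_product ls comm finite_imageI[OF finite_labels]
          span_basis_vec[OF assms(2)]])
  then show ?thesis
    unfolding complete_left_symmetric_structure_def left_symmetric_structure_def
    using bilinear_tri_product ls comm nilpotent_right_translation[OF assms(2)] by blast
qed

end
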